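(* Let $m\geq 1$ and $n>2m+1$ be integers. Let $G_m$ be the graph with vertex set $\mathbb Z_{2m}$ and edges $\{i,i+1\}$ for $1\leq i<2m-1$ and $\{0,i\}$ for $1\leq i<2m$. For $m\leq i\leq 2m-1$, let $H_i$ be the parallel connection of $G_m$ with the $n$-cycle $C_n$ along the edge $\{0,i\}$, i.e. the graph obtained from $G_m$ by adding a new path of length $n-1$ (with $n-2$ new internal vertices) joining the vertices $0$ and $i$. Then the graphs $H_m,H_{m+1},\dots,H_{2m-1}$ are mutually non-isomorphic. *)

theory Defs
  imports "Graph_Theory.Graph_Theory"
begin

text \<open>
  A finite simple graph is a finite, loop-free, symmetric digraph without parallel arcs
  (locale \<^locale>\<open>pair_graph\<close>): an undirected edge \<open>{u, v}\<close> is the pair of arcs \<open>(u, v)\<close>, \<open>(v, u)\<close>,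
  so it suffices to list each edge in one direction and close under \<^const>\<open>mk_symmetric\<close>.
  The residues modulo \<open>2m\<close> only serve as labels and are represented by \<open>0, ..., 2m - 1\<close>.
\<close>

definition fan_graph :: "nat \<Rightarrow> nat pair_pre_digraph" where
  "fan_graph m = mk_symmetric (with_proj
     \<lparr> pverts = {0..<2 * m},
       parcs = {(i, i + 1) | i. 1 \<le> i \<and> i < 2 * m - 1} \<union> {(0, i) | i. 1 \<le> i \<and> i < 2 * m} \<rparr>)"

text \<open>
  The vertices, in order, of a path of length \<open>n - 1\<close> from the old vertex \<open>u\<close> to the old
  vertex \<open>v\<close> whose \<open>n - 2\<close> internal vertices \<open>Inr 0, ..., Inr (n - 3)\<close> are new
  (meaningful for \<open>n \<ge> 3\<close>).
\<close>

definition new_path :: "nat \<Rightarrow> 'a \<Rightarrow> 'a \<Rightarrow> ('a + nat) list" where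
  "new_path n u v = Inl u # map Inr [0..<n - 2] @ [Inl v]"

text \<open>
  The parallel connection of \<open>G\<close> with the \<open>n\<close>-cycle along the edge \<open>{u, v}\<close> of \<open>G\<close>: the shared edge
  closes the new path to an \<open>n\<close>-cycle.
\<close>

definition cycle_parallel_connection ::
    "'a pair_pre_digraph \<Rightarrow> nat \<Rightarrow> 'a \<Rightarrow> 'a \<Rightarrow> ('a + nat) pair_pre_digraph" where
  "cycle_parallel_connection G n u v = mk_symmetric (with_proj
     \<lparr> pverts = Inl ` pverts G \<union> set (new_path n u v),
       parcs = map_prod Inl Inl ` parcs G \<union> set (zip (new_path n u v) (tl (new_path n u v))) \<rparr>)"

definition H_graph :: "nat \<Rightarrow> nat \<Rightarrow> nat \<Rightarrow> (nat + nat) pair_pre_digraph" where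
  "H_graph m n i = cycle_parallel_connection (fan_graph m) n 0 i"

lemma length_new_path: "n \<ge> 2 \<Longrightarrow> length (new_path n u v) = n"
  by (simp add: new_path_def)

lemma distinct_new_path: "u \<noteq> v \<Longrightarrow> distinct (new_path n u v)"
  by (auto simp: new_path_def distinct_map)

lemma pair_graph_mk_symmetric:
  fixes G :: "'a pair_pre_digraph"
  assumes fin: "finite (pverts G)"
    and arcs: "\<And>u v. (u, v) \<in> parcs G \<Longrightarrow> u \<in> pverts G \<and> v \<in> pverts G \<and> u \<noteq> v"
  shows "pair_graph (mk_symmetric (with_proj G))"
proof -
  have "parcs G \<subseteq> pverts G \<times> pverts G"
    using arcs by auto
  then have "finite (parcs G)"
    using fin by (meson finite_SigmaI finite_subset)
  then interpret pair_digraph G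
    using fin arcs by unfold_locales auto
  interpret S: pair_digraph "mk_symmetric (with_proj G)" ..
  show ?thesis
    by unfold_locales (rule symmetric_mk_symmetric)
qed

lemma pair_graph_fan_graph: "pair_graph (fan_graph m)"
  unfolding fan_graph_def by (rule pair_graph_mk_symmetric) auto

lemma pair_graph_cycle_parallel_connection:
  assumes "pair_graph G" "u \<in> pverts G" "v \<in> pverts G" "u \<noteq> v"
  shows "pair_graph (cycle_parallel_connection G n u v)"
proof -
  interpret pair_graph G by fact
  have "x \<in> set (new_path n u v) \<and> y \<in> set (new_path n u v) \<and> x \<noteq> y"
    if xy: "(x, y) \<in> set (zip (new_path n u v) (tl (new_path n u v)))" for x y
  proof -
    obtain k where k: "k < length (new_path n u v) - Suc 0"
        "x = new_path n u v ! k" "y = new_path n u v ! Suc k"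
      using xy by (auto simp: in_set_conv_nth nth_tl)
    then have "Suc k < length (new_path n u v)"
      by simp
    with k show ?thesis
      using distinct_new_path[OF assms(4), of n] by (auto simp: nth_eq_iff_index_eq)
  qed
  then show ?thesis
    unfolding cycle_parallel_connection_def
    using pair_finite_verts
    by (intro pair_graph_mk_symmetric) (auto dest: in_arcsD1 in_arcsD2 no_loops')
qed

lemma pair_graph_H_graph: "i \<in> {1..<2 * m} \<Longrightarrow> pair_graph (H_graph m n i)"
  unfolding H_graph_def
  by (intro pair_graph_cycle_parallel_connection pair_graph_fan_graph) (auto simp: fan_graph_def)

text \<open>
  For digraphs without parallel arcs, \<^const>\<open>digraph_iso\<close> is the usual notion: a bijection of
  the vertices that preserves and reflects adjacency.
\<close>

lemma digraph_iso_with_proj_iff: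
  assumes "pair_wf_digraph G" "pair_wf_digraph H"
  shows "digraph_iso (with_proj G) (with_proj H) \<longleftrightarrow>
    (\<exists>f. bij_betw f (pverts G) (pverts H) \<and>
      (\<forall>u \<in> pverts G. \<forall>v \<in> pverts G. (u, v) \<in> parcs G \<longleftrightarrow> (f u, f v) \<in> parcs H))"
    (is "?L \<longleftrightarrow> ?R")
proof
  interpret G: pair_wf_digraph G by fact
  assume ?L
  then obtain h where h: "pre_digraph.digraph_isomorphism (with_proj G) h"
      and H: "with_proj H = app_iso h (with_proj G)"
    by (auto simp: digraph_iso_def)
  let ?f = "iso_verts h"
  have V: "pverts H = ?f ` pverts G"
    using arg_cong[OF H, of verts] by simp
  have A: "parcs H = iso_arcs h ` parcs G"
    using arg_cong[OF H, of arcs] by simp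
  have t: "iso_tail h = fst" and d: "iso_head h = snd"
    using arg_cong[OF H, of tail] arg_cong[OF H, of head] by simp_all
  have inj: "inj_on ?f (pverts G)"
    and e: "\<And>a. a \<in> parcs G \<Longrightarrow> iso_arcs h a = (?f (fst a), ?f (snd a))"
    using h by (auto simp: pre_digraph.digraph_isomorphism_def t d prod_eq_iff)
  have "(u, v) \<in> parcs G \<longleftrightarrow> (?f u, ?f v) \<in> parcs H"
    if "u \<in> pverts G" "v \<in> pverts G" for u v
  proof
    assume "(u, v) \<in> parcs G"
    then show "(?f u, ?f v) \<in> parcs H" using e A by force
  next
    assume "(?f u, ?f v) \<in> parcs H"
    then obtain a where a: "a \<in> parcs G" "(?f u, ?f v) = (?f (fst a), ?f (snd a))"
      using e A by auto
    then have "a = (u, v)"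
      using inj that G.arc_fst_in_verts[of a] G.arc_snd_in_verts[of a]
      by (auto simp: prod_eq_iff dest: inj_onD)
    then show "(u, v) \<in> parcs G" using a by simp
  qed
  then show ?R using inj V by (auto simp: bij_betw_def)
next
  interpret G: pair_wf_digraph G by fact
  interpret H: pair_wf_digraph H by fact
  assume ?R
  then obtain f where f: "bij_betw f (pverts G) (pverts H)"
    "\<And>u v. u \<in> pverts G \<Longrightarrow> v \<in> pverts G \<Longrightarrow> (u, v) \<in> parcs G \<longleftrightarrow> (f u, f v) \<in> parcs H"
    by blast
  define h where "h = \<lparr> iso_verts = f, iso_arcs = map_prod f f, iso_head = snd, iso_tail = fst \<rparr>"
  have inj: "inj_on f (pverts G)" and V: "pverts H = f ` pverts G"
    using f(1) by (auto simp: bij_betw_def)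
  have sub: "parcs G \<subseteq> pverts G \<times> pverts G"
    using G.wellformed' by auto
  have "parcs H = map_prod f f ` parcs G"
  proof
    show "parcs H \<subseteq> map_prod f f ` parcs G"
    proof
      fix a assume a: "a \<in> parcs H"
      then obtain u v where uv: "u \<in> pverts G" "v \<in> pverts G" "a = (f u, f v)"
        using H.arc_fst_in_verts[OF a] H.arc_snd_in_verts[OF a] V
        by (metis imageE prod.collapse)
      then show "a \<in> map_prod f f ` parcs G" using f(2) a by force
    qed
    show "map_prod f f ` parcs G \<subseteq> parcs H" using f(2) sub by auto
  qed
  then have "with_proj H = app_iso h (with_proj G)"
    by (simp add: app_iso_def h_def with_proj_def V)
  moreover have "inj_on (map_prod f f) (parcs G)"
    using map_prod_inj_on[OF inj inj] sub by (rule inj_on_subset)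
  then have "pre_digraph.digraph_isomorphism (with_proj G) h"
    using inj G.wf_digraph
    by (auto simp: pre_digraph.digraph_isomorphism_def h_def)
  ultimately show ?L by (auto simp: digraph_iso_def)
qed

end

theory Submission
  imports Defs
begin

text \<open>
  The vertex \<open>0\<close> of \<open>H\<^sub>j\<close> is recognised by its degree \<open>2m\<close>, except that in \<open>H\<^sub>2\<close> for \<open>m = 2\<close> the
  vertex \<open>2\<close> has degree 4 as well; as isomorphism is symmetric, one may take \<open>i < j\<close>, and then
  every other vertex of \<open>H\<^sub>j\<close> has degree less than \<open>2m\<close>. The rim vertices \<open>1, ..., 2m - 1\<close> are those
  that lie in a triangle with \<open>0\<close>, and they induce a path. The vertex \<open>i\<close> is the only rim vertex
  with a neighbour that is neither \<open>0\<close> nor adjacent to \<open>0\<close>. So an isomorphism from \<open>H\<^sub>i\<close> to \<open>H\<^sub>j\<close>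
  induces an automorphism of the rim path that takes \<open>i\<close> to \<open>j\<close>; it is the identity or the
  reflection \<open>k \<mapsto> 2m - k\<close>, and for \<open>i, j \<ge> m\<close> either one gives \<open>i = j\<close>.
\<close>

section \<open>Adjacency in \<open>H_graph\<close> as arithmetic on labels\<close>

lemma set_zip_tl: "set (zip xs (tl xs)) = {(xs ! k, xs ! Suc k) | k. Suc k < length xs}"
  by (auto simp: set_zip nth_tl)

lemma nth_new_path:
  assumes "n \<ge> 2" "k < n"
  shows "new_path n u v ! k = (if k = 0 then Inl u else if k < n - 1 then Inr (k - 1) else Inl v)"
  using assms by (auto simp: new_path_def nth_Cons nth_append split: nat.split)

lemma new_path_arcs:
  assumes "n \<ge> 3"
  shows "set (zip (new_path n u v) (tl (new_path n u v))) =
    {(Inl u, Inr 0), (Inr (n - 3), Inl v)} \<union> {(Inr k, Inr (Suc k)) | k. Suc k < n - 2}"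
    (is "?L = ?R")
proof
  have L: "?L = {(new_path n u v ! k, new_path n u v ! Suc k) | k. Suc k < n}"
    using assms by (simp add: set_zip_tl length_new_path)
  show "?L \<subseteq> ?R"
  proof
    fix e assume "e \<in> ?L"
    then obtain k where k: "e = (new_path n u v ! k, new_path n u v ! Suc k)" "Suc k < n"
      unfolding L by blast
    consider "k = 0" | k' where "k = Suc k'" "Suc k' < n - 2" | "k = n - 2"
      using k(2) by (cases k) (auto, linarith)
    then show "e \<in> ?R"
      using k assms by cases (auto simp: nth_new_path)
  qed
  have "(Inl u, Inr 0) \<in> ?L"
    unfolding L using assms by (auto simp: nth_new_path intro!: exI[of _ 0])
  moreover have "(Inr (n - 3), Inl v) \<in> ?L"
    unfolding L using assms by (auto simp: nth_new_path intro!: exI[of _ "n - 2"])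
  moreover have "(Inr k, Inr (Suc k)) \<in> ?L" if "Suc k < n - 2" for k
    unfolding L using assms that by (auto simp: nth_new_path intro!: exI[of _ "Suc k"])
  ultimately show "?R \<subseteq> ?L" by auto
qed

lemma mk_symmetric_with_proj_arcs:
  "(x, y) \<in> parcs (mk_symmetric (with_proj G)) \<longleftrightarrow> (x, y) \<in> parcs G \<or> (y, x) \<in> parcs G"
  by (simp add: parcs_mk_symmetric Bex_def split_paired_Ex) blast

text \<open>The clauses for consecutive labels also cover the pair 0, 1, which is harmless because
  that pair is a spoke.\<close>

lemma fan_graph_arcs:
  "(a, b) \<in> parcs (fan_graph m) \<longleftrightarrow>
    a < 2 * m \<and> b < 2 * m \<and> a \<noteq> b \<and> (a = 0 \<or> b = 0 \<or> b = Suc a \<or> a = Suc b)"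
  unfolding fan_graph_def mk_symmetric_with_proj_arcs by auto

lemma map_prod_Inl_image_iff:
  "(x, y) \<in> map_prod Inl Inl ` A \<longleftrightarrow> (\<exists>a b. x = Inl a \<and> y = Inl b \<and> (a, b) \<in> A)"
  by auto

lemma H_graph_verts:
  "n \<ge> 3 \<Longrightarrow> i \<in> {1..<2 * m} \<Longrightarrow> pverts (H_graph m n i) = Inl ` {..<2 * m} \<union> Inr ` {..<n - 2}"
  by (auto simp: H_graph_def cycle_parallel_connection_def fan_graph_def new_path_def)

lemma H_graph_arcs:
  assumes "n \<ge> 3"
  shows "(Inl a, Inl b) \<in> parcs (H_graph m n i) \<longleftrightarrow>
      a < 2 * m \<and> b < 2 * m \<and> a \<noteq> b \<and> (a = 0 \<or> b = 0 \<or> b = Suc a \<or> a = Suc b)"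
    and "(Inl a, Inr k) \<in> parcs (H_graph m n i) \<longleftrightarrow> a = 0 \<and> k = 0 \<or> a = i \<and> k = n - 3"
    and "(Inr k, Inl a) \<in> parcs (H_graph m n i) \<longleftrightarrow> a = 0 \<and> k = 0 \<or> a = i \<and> k = n - 3"
    and "(Inr k, Inr l) \<in> parcs (H_graph m n i) \<longleftrightarrow>
      l = Suc k \<and> l < n - 2 \<or> k = Suc l \<and> k < n - 2"
  unfolding H_graph_def cycle_parallel_connection_def mk_symmetric_with_proj_arcs
    pair_pre_digraph.select_convs Un_iff map_prod_Inl_image_iff new_path_arcs[OF assms]
  by (auto simp: fan_graph_arcs)

section \<open>Degrees: telling the hub apart\<close>

lemma H_graph_hub_degree:
  assumes "n \<ge> 4" "i \<in> {1..<2 * m}"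
  shows "card {y. (Inl 0, y) \<in> parcs (H_graph m n i)} = 2 * m"
proof -
  have "{y. (Inl 0, y) \<in> parcs (H_graph m n i)} = insert (Inr 0) (Inl ` {1..<2 * m})"
  proof (rule set_eqI)
    fix y show "y \<in> {y. (Inl 0, y) \<in> parcs (H_graph m n i)} \<longleftrightarrow>
        y \<in> insert (Inr 0) (Inl ` {1..<2 * m})"
      using assms by (cases y) (auto simp: H_graph_arcs)
  qed
  moreover have "card (insert (Inr 0) (Inl ` {1..<2 * m})) = 2 * m"
    using assms by (subst card_insert_disjoint) (auto simp: card_image)
  ultimately show ?thesis by simp
qed

text \<open>New vertices have degree at most 2, and rim vertices other than \<open>i\<close> at most
  3. The vertex \<open>i\<close> reaches 4 only if \<open>i < 2 * m - 1\<close>; together with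
  \<open>m < i\<close> this forces \<open>m\<close> \<ge> 3.\<close>

lemma H_graph_degree_less:
  assumes "n > 2 * m + 1" "m < i" "i < 2 * m" "x \<noteq> Inl 0"
  shows "card {y. (x, y) \<in> parcs (H_graph m n i)} < 2 * m"
proof -
  have n: "n \<ge> 3" using assms by simp
  have m: "m \<ge> 2" using assms by simp
  let ?N = "{y. (x, y) \<in> parcs (H_graph m n i)}"
  \<comment> \<open>Bounding by the length of a list allows repeated entries, so
    \<open>Inl 0\<close> and \<open>Inl (a - 1)\<close> may coincide when
    \<open>a = 1\<close>.\<close>
  have bound: "card ?N \<le> length ys" if "?N \<subseteq> set ys" for ys
    using card_mono[OF finite_set that] card_length[of ys] by linarith
  show ?thesis
  proof (cases x)
    case (Inr k)
    have "?N \<subseteq> set [if k = 0 then Inl 0 else Inr (k - 1), if k = n - 3 then Inl i else Inr (Suc k)]"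
    proof
      fix y assume "y \<in> ?N"
      then show "y \<in> set [if k = 0 then Inl 0 else Inr (k - 1), if k = n - 3 then Inl i else Inr (Suc k)]"
        using Inr n by (cases y) (auto simp: H_graph_arcs)
    qed
    from bound[OF this] show ?thesis using m by simp
  next
    case (Inl a)
    consider "a \<noteq> i" | "a = i" "i = 2 * m - 1" | "a = i" "i < 2 * m - 1"
      using assms by linarith
    then show ?thesis
    proof cases
      case 1
      have "?N \<subseteq> set [Inl 0, Inl (a - 1), Inl (Suc a)]"
      proof
        fix y assume "y \<in> ?N"
        then show "y \<in> set [Inl 0, Inl (a - 1), Inl (Suc a)]"
          using Inl 1 assms n by (cases y) (auto simp: H_graph_arcs)
      qed
      from bound[OF this] show ?thesis using m by simp
    next
      case 2
      have "?N \<subseteq> set [Inl 0, Inl (a - 1), Inr (n - 3)]"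
      proof
        fix y assume "y \<in> ?N"
        then show "y \<in> set [Inl 0, Inl (a - 1), Inr (n - 3)]"
          using Inl 2 assms n by (cases y) (auto simp: H_graph_arcs)
      qed
      from bound[OF this] show ?thesis using m by simp
    next
      case 3
      have "?N \<subseteq> set [Inl 0, Inl (a - 1), Inl (Suc a), Inr (n - 3)]"
      proof
        fix y assume "y \<in> ?N"
        then show "y \<in> set [Inl 0, Inl (a - 1), Inl (Suc a), Inr (n - 3)]"
          using Inl 3 assms n by (cases y) (auto simp: H_graph_arcs)
      qed
      from bound[OF this] show ?thesis using 3 assms by simp
    qed
  qed
qed

section \<open>Recognising the rim and the attachment vertex\<close>

lemma H_graph_rim_iff:
  assumes "n \<ge> 5" "m \<ge> 2" "i \<in> {1..<2 * m}"
  shows "(\<exists>y. (Inl 0, x) \<in> parcs (H_graph m n i) \<and> (x, y) \<in> parcs (H_graph m n i) \<and>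
      (Inl 0, y) \<in> parcs (H_graph m n i)) \<longleftrightarrow> x \<in> Inl ` {1..<2 * m}"
    (is "?L \<longleftrightarrow> ?R")
proof
  assume ?L
  then obtain y where "(Inl 0, x) \<in> parcs (H_graph m n i)" "(x, y) \<in> parcs (H_graph m n i)"
    "(Inl 0, y) \<in> parcs (H_graph m n i)" by blast
  \<comment> \<open>The only new neighbour of the hub is \<open>Inr 0\<close>; its other neighbour
    is \<open>Inr 1\<close>, which is not adjacent to the hub, so the attached cycle yields no
    triangle.\<close>
  then show ?R using assms by (cases x; cases y) (auto simp: H_graph_arcs)
next
  assume ?R
  then obtain a where a: "x = Inl a" "1 \<le> a" "a < 2 * m" by auto
  then show ?L using assms
    \<comment> \<open>The predecessor of \<open>a\<close> completes the triangle, except that for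
      \<open>a = 1\<close> it would be the hub itself; then 2, a rim vertex since \<open>m\<close>
      \<ge> 2, is used.\<close>
    by (intro exI[of _ "Inl (if a = 1 then 2 else a - 1)"]) (auto simp: H_graph_arcs)
qed

text \<open>All old vertices other than the hub are adjacent to it, so \<open>y\<close> must be new,
  and the only new vertex next to a rim vertex is \<open>Inr (n - 3)\<close>, next to
  \<open>i\<close>. It differs from \<open>Inr 0\<close> because \<open>n\<close> \<ge> 4, so it is
  not adjacent to the hub.\<close>

lemma H_graph_attachment_iff:
  assumes "n \<ge> 4" "a \<in> {1..<2 * m}" "i \<in> {1..<2 * m}"
  shows "(\<exists>y. (Inl a, y) \<in> parcs (H_graph m n i) \<and> y \<noteq> Inl 0 \<and>
      (Inl 0, y) \<notin> parcs (H_graph m n i)) \<longleftrightarrow> a = i"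
    (is "?L \<longleftrightarrow> ?R")
proof
  assume ?L
  then obtain y where "(Inl a, y) \<in> parcs (H_graph m n i)" "y \<noteq> Inl 0"
    "(Inl 0, y) \<notin> parcs (H_graph m n i)" by blast
  then show ?R using assms by (cases y) (auto simp: H_graph_arcs)
next
  assume ?R
  then show ?L using assms by (intro exI[of _ "Inr (n - 3)"]) (auto simp: H_graph_arcs)
qed

section \<open>Automorphisms of a path\<close>

lemma inj_unit_steps_linear:
  fixes g :: "nat \<Rightarrow> int"
  assumes inj: "inj_on g {1..L}"
    and step: "\<And>k. 1 \<le> k \<Longrightarrow> k < L \<Longrightarrow> \<bar>g (Suc k) - g k\<bar> = 1"
  shows "\<exists>s\<in>{1, -1}. \<forall>k\<in>{1..L}. g k = g 1 + s * (int k - 1)"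
proof -
  \<comment> \<open>For \<open>L < 2\<close> there is no step, and 1 is an arbitrary choice of
    sign.\<close>
  define s where "s = (if 2 \<le> L then g 2 - g 1 else 1)"
  have s: "s \<in> {1, -1}"
    using step[of 1] by (auto simp: s_def numeral_2_eq_2)
  have steps: "g (Suc k) - g k = s" if "1 \<le> k" "k < L" for k
    using that
  proof (induction k rule: dec_induct)
    case base
    then show ?case by (simp add: s_def numeral_2_eq_2)
  next
    case (step k)
    \<comment> \<open>A change of direction would return to the value two steps before, against
      injectivity.\<close>
    have "g (Suc (Suc k)) \<noteq> g k"
      using inj_onD[OF inj, of "Suc (Suc k)" k] step.hyps step.prems by auto
    moreover have "\<bar>g (Suc (Suc k)) - g (Suc k)\<bar> = 1"
      using assms(2)[of "Suc k"] step.prems by simp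
    ultimately show ?case using step s by auto
  qed
  have "\<forall>k\<in>{1..L}. g k = g 1 + s * (int k - 1)"
  proof
    fix k assume "k \<in> {1..L}"
    then have "1 \<le> k" "k \<le> L" by auto
    then show "g k = g 1 + s * (int k - 1)"
    proof (induction k rule: dec_induct)
      case base
      then show ?case by simp
    next
      case (step k)
      then show ?case using steps[of k] by (simp add: algebra_simps)
    qed
  qed
  then show ?thesis using s by blast
qed

text \<open>The map is linear with slope 1 or -1. Since both \<open>g 1\<close> and
  \<open>g L\<close> lie in the interval and differ by \<open>L - 1\<close>, the slope determines
  \<open>g 1\<close>: it is 1 or \<open>L\<close> respectively.\<close>

lemma path_automorphism:
  fixes g :: "nat \<Rightarrow> nat"
  assumes "g ` {1..L} \<subseteq> {1..L}" "inj_on g {1..L}"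
    and "\<And>k. 1 \<le> k \<Longrightarrow> k < L \<Longrightarrow> g (Suc k) = Suc (g k) \<or> g k = Suc (g (Suc k))"
    and k: "k \<in> {1..L}"
  shows "g k = k \<or> g k = L + 1 - k"
proof -
  have "inj_on (\<lambda>k. int (g k)) {1..L}"
    by (rule inj_onI, rule inj_onD[OF assms(2)]) simp_all
  moreover have "\<bar>int (g (Suc k)) - int (g k)\<bar> = 1" if "1 \<le> k" "k < L" for k
    using assms(3)[OF that] by auto
  ultimately have "\<exists>s\<in>{1, -1}. \<forall>k\<in>{1..L}. int (g k) = int (g 1) + s * (int k - 1)"
    by (rule inj_unit_steps_linear)
  then obtain s where s: "s \<in> {1, -1}"
      "\<And>k. k \<in> {1..L} \<Longrightarrow> int (g k) = int (g 1) + s * (int k - 1)"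
    by blast
  have "g 1 \<in> {1..L}" "g L \<in> {1..L}"
    by (rule subsetD[OF assms(1) imageI], use k in simp)+
  moreover have "int (g L) = int (g 1) + s * (int L - 1)" "int (g k) = int (g 1) + s * (int k - 1)"
    by (rule s(2), use k in simp)+
  moreover have "s = 1 \<or> s = -1" using s(1) by simp
  ultimately show ?thesis
    using k unfolding atLeastAtMost_iff by (elim disjE) auto
qed

section \<open>No isomorphism between two of the graphs\<close>

lemma H_graph_not_iso:
  assumes n: "n > 2 * m + 1" and i: "m \<le> i" "i < j" "j < 2 * m"
  shows "\<not> digraph_iso (with_proj (H_graph m n i)) (with_proj (H_graph m n j))"
proof
  assume "digraph_iso (with_proj (H_graph m n i)) (with_proj (H_graph m n j))"
  let ?V = "pverts (H_graph m n i)" and ?W = "pverts (H_graph m n j)"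
  let ?A = "parcs (H_graph m n i)" and ?B = "parcs (H_graph m n j)"
  have m: "m \<ge> 2" and ij: "i \<in> {1..<2 * m}" "j \<in> {1..<2 * m}" and n5: "n \<ge> 5"
    using assms by auto
  interpret G: pair_graph "H_graph m n i" by (rule pair_graph_H_graph) fact
  interpret H: pair_graph "H_graph m n j" by (rule pair_graph_H_graph) fact
  obtain f where f: "bij_betw f ?V ?W"
    and arc: "\<And>u v. u \<in> ?V \<Longrightarrow> v \<in> ?V \<Longrightarrow> (u, v) \<in> ?A \<longleftrightarrow> (f u, f v) \<in> ?B"
    using \<open>digraph_iso _ _\<close>
      digraph_iso_with_proj_iff[OF G.pair_wf_digraph_axioms H.pair_wf_digraph_axioms] by blast
  have inj: "inj_on f ?V" and onto: "f ` ?V = ?W"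
    using f by (auto simp: bij_betw_def)
  have rim: "Inl a \<in> ?V" if "a < 2 * m" for a
    using that n5 ij by (simp add: H_graph_verts)
  have hubV: "Inl 0 \<in> ?V" using rim m by simp

  have hub: "f (Inl 0) = Inl 0"
  proof (rule ccontr)
    assume "f (Inl 0) \<noteq> Inl 0"
    \<comment> \<open>The neighbourhoods of the hub and of its image correspond, so the image has
      degree \<open>2 * m\<close>. The degree bound applies to the target graph because
      \<open>m < j\<close>.\<close>
    have "f ` {y. (Inl 0, y) \<in> ?A} = {y. (f (Inl 0), y) \<in> ?B}"
    proof (intro set_eqI iffI)
      fix y assume "y \<in> f ` {y. (Inl 0, y) \<in> ?A}"
      then obtain x where x: "(Inl 0, x) \<in> ?A" "y = f x" by blast
      then have "x \<in> ?V" by (blast dest: G.in_arcsD2)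
      then show "y \<in> {y. (f (Inl 0), y) \<in> ?B}" using x arc[OF hubV] by simp
    next
      fix y assume y: "y \<in> {y. (f (Inl 0), y) \<in> ?B}"
      then obtain x where "x \<in> ?V" "y = f x" using H.in_arcsD2 onto by blast
      then show "y \<in> f ` {y. (Inl 0, y) \<in> ?A}" using y arc[OF hubV] by blast
    qed
    moreover have "card (f ` {y. (Inl 0, y) \<in> ?A}) = card {y. (Inl 0, y) \<in> ?A}"
      by (rule card_image, rule inj_on_subset[OF inj]) (auto dest: G.in_arcsD2)
    ultimately show False
      using H_graph_degree_less[OF n _ i(3) \<open>f (Inl 0) \<noteq> Inl 0\<close>] H_graph_hub_degree[of n i m]
        ij(1) i n5 by simp
  qed

  have rim_image: "f (Inl a) \<in> Inl ` {1..<2 * m}" if a: "a \<in> {1..<2 * m}" for a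
  proof -
    obtain y where y: "(Inl 0, Inl a) \<in> ?A" "(Inl a, y) \<in> ?A" "(Inl 0, y) \<in> ?A"
      using H_graph_rim_iff[OF n5 m ij(1), of "Inl a"] a by blast
    then have "y \<in> ?V" by (blast dest: G.in_arcsD2)
    then have "(Inl 0, f (Inl a)) \<in> ?B" "(f (Inl a), f y) \<in> ?B" "(Inl 0, f y) \<in> ?B"
      using y arc[of "Inl 0"] arc[of "Inl a" y] hub hubV rim[of a] a by auto
    then show ?thesis using H_graph_rim_iff[OF n5 m ij(2)] by blast
  qed
  \<comment> \<open>The value of \<open>projl\<close> is meaningful here since \<open>f\<close> maps
    rim vertices to rim vertices.\<close>
  define g where "g a = projl (f (Inl a))" for a
  have g: "f (Inl a) = Inl (g a)" "g a \<in> {1..<2 * m}" if "a \<in> {1..<2 * m}" for a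
    using rim_image[OF that] by (auto simp: g_def)

  have "g i = j"
  proof -
    obtain y where y: "(Inl i, y) \<in> ?A" "y \<noteq> Inl 0" "(Inl 0, y) \<notin> ?A"
      using H_graph_attachment_iff[of n i m i] ij n5 by auto
    then have "y \<in> ?V" by (blast dest: G.in_arcsD2)
    then have "(Inl (g i), f y) \<in> ?B" "f y \<noteq> Inl 0" "(Inl 0, f y) \<notin> ?B"
      using y arc[of "Inl i" y] arc[of "Inl 0" y] hub hubV rim[of i] g(1)[OF ij(1)] ij
        inj_onD[OF inj, of y "Inl 0"] by auto
    then show ?thesis
      using H_graph_attachment_iff[of n "g i" m j] g(2)[OF ij(1)] ij n5 by auto
  qed
  moreover have "g i = i \<or> g i = (2 * m - 1) + 1 - i"
  proof (rule path_automorphism)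
    show "g ` {1..2 * m - 1} \<subseteq> {1..2 * m - 1}"
      using g(2) by force
    show "inj_on g {1..2 * m - 1}"
    proof (rule inj_onI)
      fix a b assume "a \<in> {1..2 * m - 1}" "b \<in> {1..2 * m - 1}" "g a = g b"
      then show "a = b"
        using g(1)[of a] g(1)[of b] rim[of a] rim[of b] inj_onD[OF inj, of "Inl a" "Inl b"] by auto
    qed
    fix k assume "1 \<le> k" "k < 2 * m - 1"
    then have k: "1 \<le> k" "Suc k < 2 * m" by auto
    then have "(Inl k, Inl (Suc k)) \<in> ?A" using n5 by (simp add: H_graph_arcs)
    then have "(Inl (g k), Inl (g (Suc k))) \<in> ?B"
      using arc[of "Inl k" "Inl (Suc k)"] rim[of k] rim[of "Suc k"] g(1)[of k] g(1)[of "Suc k"] k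
      by simp
    then show "g (Suc k) = Suc (g k) \<or> g k = Suc (g (Suc k))"
      using g(2)[of k] g(2)[of "Suc k"] k n5 by (auto simp: H_graph_arcs)
  qed (use ij in auto)
  \<comment> \<open>The identity would give \<open>j = i\<close>, and the reflection
    \<open>j = 2 * m - i\<close> \<le> \<open>m\<close> \<le> \<open>i\<close>; both contradict
    \<open>i < j\<close>.\<close>
  ultimately show False using i by auto
qed

theorem theorem5p1:
  fixes m n :: nat
  assumes "m \<ge> 1" and "n > 2 * m + 1"
  shows "\<forall>i\<in>{m..2 * m - 1}. \<forall>j\<in>{m..2 * m - 1}. i \<noteq> j \<longrightarrow>
    \<not> digraph_iso (with_proj (H_graph m n i)) (with_proj (H_graph m n j))"
proof (intro ballI impI)
  fix i j assume ij: "i \<in> {m..2 * m - 1}" "j \<in> {m..2 * m - 1}" and "i \<noteq> j"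
  interpret G: pair_graph "H_graph m n i" by (rule pair_graph_H_graph) (use ij assms in auto)
  consider "i < j" | "j < i" using \<open>i \<noteq> j\<close> by linarith
  then show "\<not> digraph_iso (with_proj (H_graph m n i)) (with_proj (H_graph m n j))"
  proof cases
    case 1
    then show ?thesis using H_graph_not_iso[of m n i j] ij assms by auto
  next
    case 2
    then have "\<not> digraph_iso (with_proj (H_graph m n j)) (with_proj (H_graph m n i))"
      using H_graph_not_iso[of m n j i] ij assms by auto
    then show ?thesis using digraph_iso_swap[OF G.wf_digraph] by blast
  qed
qed

end
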